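(* Let $G$ be a connected bipartite graph with $n\geq 4$ vertices and let $F=\sum_{i=1}^n d_i^3$. Then $$EE(G)\leq n-2+2\cosh\sqrt{F}$$ with equality if and only if $G\cong K_{s,t}$ with $s+t=n$.
   Context: $G$ is a simple undirected graph on vertices $v_1,\dots,v_n$ with degrees $d_i$. The Sombor matrix $\mathcal{S}(G)$ has $(i,j)$-entry $\sqrt{d_i^2+d_j^2}$ if $v_i,v_j$ are adjacent and $0$ otherwise, with eigenvalues $\rho_1,\dots,\rho_n$. The Sombor Estrada index is $EE(G)=\sum_{i=1}^n e^{\rho_i}$. $K_{s,t}$ is the complete bipartite graph. *)

theory Defs
  imports
    Complex_Main
    "Jordan_Normal_Form.Char_Poly"
    "Graph_Theory.Graph_Theory"
begin

text \<open>
  A finite simple undirected graph is a \<^const>\<open>pair_graph\<close>: a finite loop-free digraph without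
  parallel arcs whose arc relation is symmetric, each edge being represented by its two
  orientations.  The number of neighbours of a vertex is therefore its out-degree.
\<close>

definition vdegree :: "'a pair_pre_digraph \<Rightarrow> 'a \<Rightarrow> nat" where
  "vdegree G u = out_degree (with_proj G) u"

definition bipartite_graph :: "'a pair_pre_digraph \<Rightarrow> bool" where
  "bipartite_graph G \<longleftrightarrow>
     (\<exists>U V. pverts G = U \<union> V \<and> U \<inter> V = {} \<and>
        (\<forall>(u, w) \<in> parcs G. (u \<in> U \<and> w \<in> V) \<or> (u \<in> V \<and> w \<in> U)))"

text \<open>The vertices are enumerated as \<open>v 0, \<dots>, v (n - 1)\<close>.\<close>

definition sombor_matrix :: "'a pair_pre_digraph \<Rightarrow> (nat \<Rightarrow> 'a) \<Rightarrow> nat \<Rightarrow> real mat" where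
  "sombor_matrix G v n =
     mat n n (\<lambda>(i, j). if (v i, v j) \<in> parcs G
                       then sqrt (real (vdegree G (v i)) ^ 2 + real (vdegree G (v j)) ^ 2)
                       else 0)"

text \<open>
  The eigenvalues with their multiplicities are the roots of the characteristic polynomial.  Taking
  the roots in the reals loses none of them for a \<^const>\<open>pair_graph\<close>, where the Sombor matrix is
  real symmetric.
\<close>

definition sombor_eigenvalues :: "'a pair_pre_digraph \<Rightarrow> (nat \<Rightarrow> 'a) \<Rightarrow> nat \<Rightarrow> real multiset" where
  "sombor_eigenvalues G v n = proots (char_poly (sombor_matrix G v n))"

definition sombor_estrada :: "'a pair_pre_digraph \<Rightarrow> (nat \<Rightarrow> 'a) \<Rightarrow> nat \<Rightarrow> real" where
  "sombor_estrada G v n = (\<Sum>\<rho>\<in>#sombor_eigenvalues G v n. exp \<rho>)"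

end

theory Submission
  imports Defs "Jordan_Normal_Form.Schur_Decomposition"
begin

text \<open>
  For a bipartite graph the Sombor matrix \<open>S\<close> is similar to \<open>-S\<close>, so its spectrum is symmetric
  about \<open>0\<close> and \<open>EE(G)\<close> is the sum of the \<open>cosh \<rho>\<close>.  Since \<open>tr S\<^sup>2 = 2 F\<close> and every nonzero
  eigenvalue is paired with its negative, \<open>\<rho>\<^sup>2 \<le> F\<close>.  As \<open>(cosh x - 1) / x\<^sup>2\<close> increases strictly
  for \<open>x > 0\<close>, we get \<open>cosh \<rho> - 1 \<le> (\<rho>\<^sup>2 / F) (cosh \<surd>F - 1)\<close>; summing gives the bound, with
  equality iff \<open>\<rho>\<^sup>3 = F \<rho>\<close> for all eigenvalues, that is, iff \<open>S\<^sup>3 = F S\<close>.  That matrix equation says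
  in particular that the ends of every walk of length three are adjacent, which forces a connected
  bipartite graph to be complete bipartite.
\<close>

section \<open>Inequalities for \<open>sinh\<close> and \<open>cosh\<close>\<close>

lemma DERIV_sinh_cosh: "(sinh has_real_derivative cosh x) (at x)"
  by (auto intro!: derivative_eq_intros)

text \<open>The mean value theorem gives slope \<open>cosh a\<close> for \<open>sinh\<close> on the
  interval from 0 to \<open>y\<close> and slope \<open>cosh b\<close> on that from \<open>y\<close>
  to \<open>z\<close>. Since \<open>a < y < b\<close>, the second slope is larger, so
  \<open>sinh x / x\<close> increases.\<close>

lemma sinh_ratio_strict_mono:
  fixes y z :: real
  assumes "0 < y" "y < z"
  shows "z * sinh y < y * sinh z"
proof -
  obtain a where a: "0 < a" "a < y" "sinh y - sinh 0 = (y - 0) * cosh a"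
    using MVT2[OF assms(1), of sinh cosh] by (metis DERIV_sinh_cosh)
  obtain b where b: "y < b" "b < z" "sinh z - sinh y = (z - y) * cosh b"
    using MVT2[OF assms(2), of sinh cosh] by (metis DERIV_sinh_cosh)
  have "cosh a < cosh b"
    using a b by (subst cosh_real_nonneg_less_iff) auto
  then have "(z - y) * cosh a < (z - y) * cosh b"
    using assms by simp
  then have "z * cosh a < sinh z"
    using a b by (simp add: algebra_simps)
  then show ?thesis
    using a assms by (simp add: mult_ac)
qed

lemma cosh_minus_one: "cosh x - 1 = 2 * (sinh (x / 2))\<^sup>2" for x :: real
  using cosh_double_cosh[of "x / 2"] cosh_square_eq[of "x / 2"] by simp

text \<open>By the half-argument identity, \<open>(cosh x - 1) / x^2\<close> is half the square of
  \<open>sinh (x/2) / (x/2)\<close>, so it inherits the monotonicity of that quotient.\<close>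

lemma cosh_minus_one_ratio_strict_mono:
  fixes y z :: real
  assumes "0 < y" "y < z"
  shows "z\<^sup>2 * (cosh y - 1) < y\<^sup>2 * (cosh z - 1)"
proof -
  have "z / 2 * sinh (y / 2) < y / 2 * sinh (z / 2)"
    using assms by (intro sinh_ratio_strict_mono) auto
  then have "(z / 2 * sinh (y / 2))\<^sup>2 < (y / 2 * sinh (z / 2))\<^sup>2"
    using assms by (intro power_strict_mono) auto
  then show ?thesis
    by (simp add: cosh_minus_one power_mult_distrib power_divide)
qed

text \<open>In the variable \<open>u = r^2\<close>, the graph of \<open>cosh (sqrt u) - 1\<close>
  lies below its chord from 0 to \<open>F\<close> and meets it only at the two ends. As
  \<open>cosh\<close> is even, \<open>r\<close> may be replaced by its absolute value.\<close>

lemma cosh_minus_one_chord: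
  fixes F r :: real
  assumes "0 < F" "r\<^sup>2 \<le> F"
  shows "F * (cosh r - 1) \<le> r\<^sup>2 * (cosh (sqrt F) - 1)"
    and "F * (cosh r - 1) = r\<^sup>2 * (cosh (sqrt F) - 1) \<longleftrightarrow> r = 0 \<or> r\<^sup>2 = F"
proof -
  have "F * (cosh r - 1) < r\<^sup>2 * (cosh (sqrt F) - 1)" if "r \<noteq> 0" "r\<^sup>2 \<noteq> F"
  proof -
    have "\<bar>r\<bar> < sqrt F"
      using that assms by (intro real_less_rsqrt) auto
    then show ?thesis
      using cosh_minus_one_ratio_strict_mono[of "\<bar>r\<bar>" "sqrt F"] that assms by simp
  qed
  moreover have "F * (cosh r - 1) = r\<^sup>2 * (cosh (sqrt F) - 1)" if "r = 0 \<or> r\<^sup>2 = F"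
    using that
  proof
    assume "r\<^sup>2 = F"
    then have "sqrt F = \<bar>r\<bar>" by auto
    then show ?thesis using \<open>r\<^sup>2 = F\<close> by simp
  qed simp
  ultimately show "F * (cosh r - 1) \<le> r\<^sup>2 * (cosh (sqrt F) - 1)"
    and "F * (cosh r - 1) = r\<^sup>2 * (cosh (sqrt F) - 1) \<longleftrightarrow> r = 0 \<or> r\<^sup>2 = F"
    by fastforce+
qed

section \<open>Traces, triangular matrices and power sums of eigenvalues\<close>

lemma index_mult_mat_sum:
  assumes "A \<in> carrier_mat n m" "B \<in> carrier_mat m p" "i < n" "j < p"
  shows "(A * B) $$ (i, j) = (\<Sum>k<m. A $$ (i, k) * B $$ (k, j))"
  using assms by (auto simp: scalar_prod_def atLeast0LessThan intro!: sum.cong)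

lemma sum_diag_mult_commute:
  fixes A B :: "'a :: comm_semiring_0 mat"
  assumes "A \<in> carrier_mat n n" "B \<in> carrier_mat n n"
  shows "(\<Sum>i<n. (A * B) $$ (i, i)) = (\<Sum>i<n. (B * A) $$ (i, i))"
proof -
  have "(\<Sum>i<n. (A * B) $$ (i, i)) = (\<Sum>i<n. \<Sum>k<n. A $$ (i, k) * B $$ (k, i))"
    using assms by (intro sum.cong) (auto simp: index_mult_mat_sum[of _ n n] simp del: index_mult_mat)
  also have "\<dots> = (\<Sum>k<n. \<Sum>i<n. B $$ (k, i) * A $$ (i, k))"
    by (subst sum.swap) (simp add: mult.commute)
  also have "\<dots> = (\<Sum>i<n. (B * A) $$ (i, i))"
    using assms by (intro sum.cong) (auto simp: index_mult_mat_sum[of _ n n] simp del: index_mult_mat)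
  finally show ?thesis .
qed

lemma sum_diag_similar:
  fixes A B :: "'a :: comm_ring_1 mat"
  assumes "similar_mat_wit A B P Q" "A \<in> carrier_mat n n"
  shows "(\<Sum>i<n. A $$ (i, i)) = (\<Sum>i<n. B $$ (i, i))"
proof -
  note D = similar_mat_witD2[OF assms(2,1)]
  have "(\<Sum>i<n. A $$ (i, i)) = (\<Sum>i<n. (Q * (P * B)) $$ (i, i))"
    unfolding D(3) using D by (intro sum_diag_mult_commute) auto
  also have "Q * (P * B) = B"
    using D by (simp flip: assoc_mult_mat[of Q n n P n B n])
  finally show ?thesis .
qed

lemma upper_triangular_mult:
  fixes A B :: "'a :: semiring_0 mat"
  assumes A: "A \<in> carrier_mat n n" "upper_triangular A"
    and B: "B \<in> carrier_mat n n" "upper_triangular B"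
  shows "upper_triangular (A * B)"
    and "i < n \<Longrightarrow> (A * B) $$ (i, i) = A $$ (i, i) * B $$ (i, i)"
proof -
  show "upper_triangular (A * B)"
  proof (rule upper_triangularI)
    fix i j assume ij: "j < i" "i < dim_row (A * B)"
    have "A $$ (i, k) * B $$ (k, j) = 0" if "k < n" for k
      using upper_triangularD[OF A(2), of k i] upper_triangularD[OF B(2), of j k] A B ij that
      by (cases "k < i") auto
    then show "(A * B) $$ (i, j) = 0"
      using ij A B index_mult_mat_sum[of A n n B n i j] by simp
  qed
  show "(A * B) $$ (i, i) = A $$ (i, i) * B $$ (i, i)" if i: "i < n"
  proof -
    \<comment> \<open>For \<open>k < i\<close> the factor from \<open>A\<close> lies below the
      diagonal, for \<open>k > i\<close> the factor from \<open>B\<close> does; only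
      \<open>k = i\<close> survives.\<close>
    have "A $$ (i, k) * B $$ (k, i) = (if k = i then A $$ (i, i) * B $$ (i, i) else 0)"
      if "k < n" for k
      using upper_triangularD[OF A(2), of k i] upper_triangularD[OF B(2), of i k] A B i that
      by (cases k i rule: linorder_cases) auto
    then have "(\<Sum>k<n. A $$ (i, k) * B $$ (k, i))
        = (\<Sum>k<n. if k = i then A $$ (i, i) * B $$ (i, i) else 0)"
      by (intro sum.cong) auto
    also have "\<dots> = A $$ (i, i) * B $$ (i, i)"
      using i by simp
    finally show ?thesis
      using index_mult_mat_sum[OF A(1) B(1) i i] by simp
  qed
qed

lemma upper_triangular_pow:
  fixes A :: "'a :: semiring_1 mat"
  assumes "A \<in> carrier_mat n n" "upper_triangular A"
  shows "upper_triangular (A ^\<^sub>m k) \<and> (\<forall>i<n. (A ^\<^sub>m k) $$ (i, i) = A $$ (i, i) ^ k)"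
proof (induction k)
  case 0
  then show ?case using assms by auto
next
  case (Suc k)
  moreover have "A ^\<^sub>m k \<in> carrier_mat n n" using assms by simp
  ultimately show ?case
    using upper_triangular_mult[of "A ^\<^sub>m k" n A] assms
    by (simp add: power_commutes del: index_mult_mat)
qed

text \<open>Schur decomposition makes \<open>A\<close> similar to a triangular matrix with diagonal
  \<open>es\<close>. Its k-th power is again triangular, with the k-th powers on the diagonal, and
  similarity preserves the trace.\<close>

lemma sum_diag_pow_eigenvalues:
  fixes A :: "'a :: conjugatable_ordered_field mat"
  assumes A: "A \<in> carrier_mat n n" and es: "char_poly A = (\<Prod>e\<leftarrow>es. [:- e, 1:])"
  shows "(\<Sum>i<n. (A ^\<^sub>m k) $$ (i, i)) = (\<Sum>e\<leftarrow>es. e ^ k)"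
proof -
  obtain B P Q where "schur_decomposition A es = (B, P, Q)"
    by (cases "schur_decomposition A es")
  then have sim: "similar_mat_wit A B P Q" and ut: "upper_triangular B" and diag: "diag_mat B = es"
    using schur_decomposition[OF A es] by auto
  have B: "B \<in> carrier_mat n n" using similar_mat_witD2[OF A sim] by auto
  have "(\<Sum>i<n. (A ^\<^sub>m k) $$ (i, i)) = (\<Sum>i<n. (B ^\<^sub>m k) $$ (i, i))"
    using A by (intro sum_diag_similar[OF similar_mat_wit_pow[OF sim]]) auto
  also have "\<dots> = (\<Sum>i<n. B $$ (i, i) ^ k)"
    using upper_triangular_pow[OF B ut] by simp
  also have "\<dots> = (\<Sum>e\<leftarrow>es. e ^ k)"
    using B unfolding diag[symmetric] diag_mat_def
    by (simp add: sum_list_distinct_conv_sum_set atLeast0LessThan o_def)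
  finally show ?thesis .
qed

lemma char_poly_uminus_eigenvalues:
  fixes A :: "'a :: conjugatable_ordered_field mat"
  assumes A: "A \<in> carrier_mat n n" and es: "char_poly A = (\<Prod>e\<leftarrow>es. [:- e, 1:])"
  shows "char_poly ((-1) \<cdot>\<^sub>m A) = (\<Prod>e\<leftarrow>map uminus es. [:- e, 1:])"
proof -
  obtain B P Q where "schur_decomposition A es = (B, P, Q)"
    by (cases "schur_decomposition A es")
  then have sim: "similar_mat_wit A B P Q" and ut: "upper_triangular B" and diag: "diag_mat B = es"
    using schur_decomposition[OF A es] by auto
  have B: "B \<in> carrier_mat n n" using similar_mat_witD2[OF A sim] by auto
  have "similar_mat ((-1) \<cdot>\<^sub>m A) ((-1) \<cdot>\<^sub>m B)"
    using sim by (intro similar_mat_smult) (auto simp: similar_mat_def)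
  then have "char_poly ((-1) \<cdot>\<^sub>m A) = char_poly ((-1) \<cdot>\<^sub>m B)"
    by (rule char_poly_similar)
  also have "\<dots> = (\<Prod>e\<leftarrow>diag_mat ((-1) \<cdot>\<^sub>m B). [:- e, 1:])"
    using B ut by (intro char_poly_upper_triangular[of _ n]) (auto simp: upper_triangular_def)
  also have "diag_mat ((-1) \<cdot>\<^sub>m B) = map uminus es"
    using B unfolding diag[symmetric] by (auto simp: diag_mat_def)
  finally show ?thesis .
qed

lemma proots_prod_linear: "proots (\<Prod>e\<leftarrow>es. [:- e, 1:]) = mset es" for es :: "'a :: idom list"
proof (induction es)
  case (Cons e es)
  have "(\<Prod>e\<leftarrow>es. [:- e, 1:]) \<noteq> 0" by (auto simp: prod_list_zero_iff)
  then show ?case using Cons by (simp add: proots_mult del: mult_pCons_left)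
qed simp

section \<open>Real spectrum of real symmetric matrices\<close>

text \<open>For an eigenvector \<open>x\<close>, the Hermitian form \<open>q\<close> is its own
  conjugate by symmetry of \<open>A\<close>, and it equals \<open>z\<close> times the positive real
  \<open>N\<close>, the squared norm of \<open>x\<close>.\<close>

lemma eigenvalue_symmetric_real:
  fixes A :: "real mat"
  assumes A: "A \<in> carrier_mat n n" and sym: "\<And>i j. i < n \<Longrightarrow> j < n \<Longrightarrow> A $$ (i, j) = A $$ (j, i)"
    and ev: "eigenvalue (map_mat complex_of_real A) z"
  shows "z \<in> \<real>"
proof -
  obtain x where x: "x \<in> carrier_vec n" "x \<noteq> 0\<^sub>v n" "map_mat complex_of_real A *\<^sub>v x = z \<cdot>\<^sub>v x"
    using ev A by (auto simp: eigenvalue_def eigenvector_def)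
  have row: "(\<Sum>j<n. A $$ (i, j) * x $ j) = z * x $ i" if "i < n" for i
    using arg_cong[OF x(3), of "\<lambda>u. u $ i"] that A x(1)
    by (simp add: scalar_prod_def atLeast0LessThan)
  define q where "q = (\<Sum>i<n. \<Sum>j<n. cnj (x $ i) * A $$ (i, j) * x $ j)"
  define N where "N = (\<Sum>i<n. (cmod (x $ i))\<^sup>2)"
  have "cnj q = (\<Sum>i<n. \<Sum>j<n. x $ i * A $$ (i, j) * cnj (x $ j))"
    by (simp add: q_def)
  also have "\<dots> = q"
    unfolding q_def by (subst sum.swap) (auto intro!: sum.cong simp: sym mult_ac)
  finally have "q \<in> \<real>" by (simp add: Reals_cnj_iff)
  have "q = (\<Sum>i<n. cnj (x $ i) * (z * x $ i))"
    by (simp add: q_def sum_distrib_left mult.assoc flip: row)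
  also have "\<dots> = z * of_real N"
    by (simp add: N_def sum_distrib_left complex_norm_square mult_ac flip: of_real_power)
  finally have "q = z * of_real N" .
  moreover obtain i where "i < n" "x $ i \<noteq> 0"
    using x(1,2) by (metis carrier_vecD eq_vecI index_zero_vec)
  then have "N > 0" unfolding N_def by (intro sum_pos2[of _ i]) auto
  ultimately have "z = q / of_real N" by simp
  then show ?thesis using \<open>q \<in> \<real>\<close> by simp
qed

text \<open>The polynomial splits over the complex numbers, and all its roots are real. The
  factorization is then pulled back along the injective embedding of real polynomials. So the real
  roots account for all \<open>n\<close> eigenvalues.\<close>

lemma char_poly_symmetric_splits:
  fixes A :: "real mat"
  assumes A: "A \<in> carrier_mat n n" and sym: "\<And>i j. i < n \<Longrightarrow> j < n \<Longrightarrow> A $$ (i, j) = A $$ (j, i)"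
  obtains es where "char_poly A = (\<Prod>e\<leftarrow>es. [:- e, 1:])" "length es = n"
proof -
  interpret ph: map_poly_inj_idom_hom complex_of_real ..
  let ?A = "map_mat complex_of_real A"
  have cA: "?A \<in> carrier_mat n n" using A by simp
  obtain zs where zs: "char_poly ?A = (\<Prod>z\<leftarrow>zs. [:- z, 1:])" "length zs = n"
    using char_poly_factorized[OF cA] by blast
  have real: "z \<in> \<real>" if "z \<in> set zs" for z
  proof (rule eigenvalue_symmetric_real[OF A sym])
    have "poly (char_poly ?A) z = 0"
      using that by (auto simp: zs poly_prod_list prod_list_zero_iff)
    then show "eigenvalue ?A z" using eigenvalue_root_char_poly[OF cA] by simp
  qed auto
  have zs_Re: "map complex_of_real (map Re zs) = zs"
    using real by (auto simp: o_def intro!: map_idI)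
  have "map_poly complex_of_real (char_poly A) = char_poly ?A"
    by (rule of_real_hom.char_poly_hom[OF A, symmetric])
  also have "\<dots> = (\<Prod>z\<leftarrow>map complex_of_real (map Re zs). [:- z, 1:])"
    by (simp only: zs zs_Re)
  also have "\<dots> = map_poly complex_of_real (\<Prod>e\<leftarrow>map Re zs. [:- e, 1:])"
    by (simp add: ph.hom_prod_list o_def)
  finally have "char_poly A = (\<Prod>e\<leftarrow>map Re zs. [:- e, 1:])"
    by (rule ph.injectivity)
  then show ?thesis using that[of "map Re zs"] zs by simp
qed

section \<open>The equation \<open>A^3 = c A\<close> and its spectral form\<close>

lemma pow_mat_add:
  fixes A :: "'a :: semiring_1 mat"
  assumes "A \<in> carrier_mat n n"
  shows "A ^\<^sub>m (k + l) = A ^\<^sub>m k * A ^\<^sub>m l"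
proof (induction l)
  case (Suc l)
  then show ?case using assms by (simp add: assoc_mult_mat[of _ n n _ n _ n])
qed (use assms in simp)

lemma pow_mat_symmetric:
  fixes A :: "'a :: comm_semiring_1 mat"
  assumes "A \<in> carrier_mat n n" "transpose_mat A = A"
  shows "transpose_mat (A ^\<^sub>m k) = A ^\<^sub>m k"
proof (induction k)
  case 0
  then show ?case by simp
next
  case (Suc k)
  then have "transpose_mat (A ^\<^sub>m Suc k) = A ^\<^sub>m 1 * A ^\<^sub>m k"
    using assms by (simp add: transpose_mult[of _ n n _ n])
  then show ?case
    using pow_mat_add[OF assms(1), of 1 k] by simp
qed

lemma symmetric_cube_eq_smult:
  fixes A :: "real mat"
  assumes A: "A \<in> carrier_mat n n" and sym: "transpose_mat A = A"
    and es: "char_poly A = (\<Prod>e\<leftarrow>es. [:- e, 1:])"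
    and cube: "\<And>e. e \<in> set es \<Longrightarrow> e ^ 3 = c * e"
  shows "A ^\<^sub>m 3 = c \<cdot>\<^sub>m A"
proof -
  define X where "X = A ^\<^sub>m 3"
  have X: "X \<in> carrier_mat n n" using A by (simp add: X_def)
  have A_sym: "A $$ (j, i) = A $$ (i, j)" if "i < n" "j < n" for i j
    using arg_cong[OF sym, of "\<lambda>M. M $$ (i, j)"] A that by simp
  have X_sym: "X $$ (j, i) = X $$ (i, j)" if "i < n" "j < n" for i j
    using arg_cong[OF pow_mat_symmetric[OF A sym, of 3], of "\<lambda>M. M $$ (i, j)"] X that
    unfolding X_def[symmetric] by simp
  have tr: "(\<Sum>i<n. \<Sum>j<n. (A ^\<^sub>m k) $$ (i, j) * (A ^\<^sub>m l) $$ (j, i)) = (\<Sum>e\<leftarrow>es. e ^ (k + l))"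
    for k l
    using A by (simp add: pow_mat_add[OF A] index_mult_mat_sum[of _ n n _ n]
        flip: sum_diag_pow_eigenvalues[OF A es] del: index_mult_mat)
  have A1: "A ^\<^sub>m 1 = A" using A by simp
  \<comment> \<open>The left-hand side is the trace of the square of the symmetric matrix \<open>A\<^sup>3 - c A\<close>.\<close>
  have "(\<Sum>i<n. \<Sum>j<n. (X $$ (i, j) - c * A $$ (i, j))\<^sup>2)
      = (\<Sum>i<n. \<Sum>j<n. X $$ (i, j) * X $$ (j, i) - 2 * c * (X $$ (i, j) * A $$ (j, i))
          + c\<^sup>2 * (A $$ (i, j) * A $$ (j, i)))"
    by (intro sum.cong refl) (simp add: A_sym X_sym power2_eq_square algebra_simps)
  also have "\<dots> = (\<Sum>e\<leftarrow>es. e ^ 6) - 2 * c * (\<Sum>e\<leftarrow>es. e ^ 4) + c\<^sup>2 * (\<Sum>e\<leftarrow>es. e ^ 2)"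
    using tr[of 3 3] tr[of 3 1] tr[of 1 1, unfolded one_add_one] unfolding A1 X_def[symmetric]
    by (simp add: sum.distrib sum_subtractf flip: sum_distrib_left)
  also have "\<dots> = (\<Sum>e\<leftarrow>es. (e ^ 3 - c * e)\<^sup>2)"
    by (induction es) (auto simp: algebra_simps power2_eq_square eval_nat_numeral)
  also have "\<dots> = 0"
    using cube by (subst sum_list_nonneg_eq_0_iff) auto
  finally have "\<forall>i<n. \<forall>j<n. X $$ (i, j) = c * A $$ (i, j)"
    by (simp add: sum_nonneg_eq_0_iff sum_nonneg)
  then show ?thesis
    using A X unfolding X_def by (intro eq_matI) auto
qed

lemma eigenvalue_cube:
  fixes A :: "'a :: field mat"
  assumes A: "A \<in> carrier_mat n n" and cube: "A ^\<^sub>m 3 = c \<cdot>\<^sub>m A" and ev: "eigenvalue A e"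
  shows "e ^ 3 = c * e"
proof -
  obtain x where x: "eigenvector A x e" using ev by (auto simp: eigenvalue_def)
  then have xc: "x \<in> carrier_vec n" "x \<noteq> 0\<^sub>v n" "A *\<^sub>v x = e \<cdot>\<^sub>v x"
    using A by (auto simp: eigenvector_def)
  then obtain i where i: "i < n" "x $ i \<noteq> 0"
    by (metis carrier_vecD eq_vecI index_zero_vec)
  have "(c \<cdot>\<^sub>m A) *\<^sub>v x = c \<cdot>\<^sub>v (A *\<^sub>v x)"
    using A xc(1) by (intro eq_vecI) auto
  then have "e ^ 3 \<cdot>\<^sub>v x = c \<cdot>\<^sub>v (A *\<^sub>v x)"
    using eigenvector_pow[OF A x, of 3] by (simp add: cube)
  then have "(e ^ 3 \<cdot>\<^sub>v x) $ i = (c \<cdot>\<^sub>v (e \<cdot>\<^sub>v x)) $ i"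
    by (simp only: xc(3))
  then have "e ^ 3 * x $ i = c * (e * x $ i)"
    using xc(1) i by simp
  then show ?thesis using i by simp
qed

section \<open>Degrees, trace and sign symmetry of the Sombor matrix\<close>

text \<open>The arcs leaving \<open>v i\<close> correspond to the indices of its neighbours, so the
  degree becomes a row sum of the 0/1 adjacency matrix, ready for exchanges of summation.\<close>

lemma vdegree_eq_sum:
  fixes n :: nat
  assumes G: "pair_graph G" and v: "bij_betw v {..<n} (pverts G)" and i: "i < n"
  shows "real (vdegree G (v i)) = (\<Sum>j<n. of_bool ((v i, v j) \<in> parcs G))"
proof -
  interpret pair_graph G by fact
  have img: "(\<lambda>j. (v i, v j)) ` {j. j < n \<and> (v i, v j) \<in> parcs G} = out_arcs (with_proj G) (v i)"
    using v wellformed' by (fastforce simp: bij_betw_def out_arcs_def)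
  have "inj_on (\<lambda>j. (v i, v j)) {j. j < n \<and> (v i, v j) \<in> parcs G}"
    using v by (auto simp: bij_betw_def inj_on_def)
  then have "card (out_arcs (with_proj G) (v i)) = card {j. j < n \<and> (v i, v j) \<in> parcs G}"
    by (simp add: card_image flip: img)
  then show ?thesis
    unfolding vdegree_def out_degree_def
    by (subst sum_of_bool_eq) (auto intro: arg_cong[of _ _ card])
qed

lemma sombor_matrix_carrier [simp]: "sombor_matrix G v n \<in> carrier_mat n n"
  by (simp add: sombor_matrix_def)

lemma index_sombor_matrix [simp]:
  assumes "i < n" "j < n"
  shows "sombor_matrix G v n $$ (i, j) = (if (v i, v j) \<in> parcs G
     then sqrt (real (vdegree G (v i)) ^ 2 + real (vdegree G (v j)) ^ 2) else 0)"
  using assms by (simp add: sombor_matrix_def)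

lemma sombor_matrix_symmetric:
  assumes "pair_graph G"
  shows "transpose_mat (sombor_matrix G v n) = sombor_matrix G v n"
proof -
  interpret pair_graph G by fact
  show ?thesis
    using arcs_symmetric by (intro eq_matI) (auto simp: sombor_matrix_def add.commute)
qed

text \<open>Each ordered adjacent pair contributes \<open>d_i^2 + d_j^2\<close>. The term
  \<open>d_i^2\<close> occurs once for each of the \<open>d_i\<close> neighbours, giving
  \<open>d_i^3\<close>; the other term gives the same total after exchanging the sums.\<close>

lemma sum_sombor_matrix_squares:
  fixes n :: nat
  assumes G: "pair_graph G" and v: "bij_betw v {..<n} (pverts G)"
  shows "(\<Sum>i<n. (sombor_matrix G v n ^\<^sub>m 2) $$ (i, i)) = 2 * (\<Sum>i<n. real (vdegree G (v i)) ^ 3)"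
proof -
  interpret pair_graph G by fact
  let ?S = "sombor_matrix G v n" and ?d = "\<lambda>i. real (vdegree G (v i))"
  let ?a = "\<lambda>i j. of_bool ((v i, v j) \<in> parcs G) :: real"
  have "?S ^\<^sub>m 2 = ?S * ?S"
    by (simp add: eval_nat_numeral)
  then have "(\<Sum>i<n. (?S ^\<^sub>m 2) $$ (i, i)) = (\<Sum>i<n. \<Sum>j<n. ?S $$ (i, j) * ?S $$ (j, i))"
    by (simp add: index_mult_mat_sum[of _ n n _ n] del: index_mult_mat)
  also have "\<dots> = (\<Sum>i<n. \<Sum>j<n. ?d i ^ 2 * ?a i j + ?d j ^ 2 * ?a j i)"
    using arcs_symmetric by (intro sum.cong refl) (auto simp: add.commute)
  also have "\<dots> = (\<Sum>i<n. \<Sum>j<n. ?d i ^ 2 * ?a i j) + (\<Sum>j<n. \<Sum>i<n. ?d j ^ 2 * ?a j i)"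
    by (subst (3) sum.swap) (simp add: sum.distrib)
  also have "\<dots> = 2 * (\<Sum>i<n. ?d i ^ 2 * ?d i)"
    using vdegree_eq_sum[OF G v] by (simp flip: sum_distrib_left)
  finally show ?thesis
    by (simp add: eval_nat_numeral mult_ac)
qed

text \<open>Conjugation by the sign matrix \<open>D\<close>, which is its own inverse, multiplies an
  entry by the signs of its two indices. Adjacent vertices have opposite signs, so every nonzero
  entry is negated.\<close>

lemma similar_uminus_sombor_matrix:
  assumes bip: "bipartite_graph G"
  shows "similar_mat ((-1) \<cdot>\<^sub>m sombor_matrix G v n) (sombor_matrix G v n)"
proof -
  let ?S = "sombor_matrix G v n"
  obtain U V where UV: "U \<inter> V = {}"
      "\<forall>(u, w) \<in> parcs G. (u \<in> U \<and> w \<in> V) \<or> (u \<in> V \<and> w \<in> U)"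
    using bip unfolding bipartite_graph_def by blast
  define D :: "real mat" where "D = mat_diag n (\<lambda>i. if v i \<in> U then 1 else -1)"
  have D: "D \<in> carrier_mat n n" by (simp add: D_def mat_diag_def)
  have DD: "D * D = 1\<^sub>m n"
    unfolding D_def by (subst mat_diag_mult_left[of _ n n]) (auto simp: mat_diag_def)
  have "(-1) \<cdot>\<^sub>m ?S = D * ?S * D"
  proof (rule eq_matI)
    fix i j assume "i < dim_row (D * ?S * D)" "j < dim_col (D * ?S * D)"
    then have ij: "i < n" "j < n" using D by auto
    have "(D * ?S * D) $$ (i, j)
        = (if v i \<in> U then 1 else -1) * ?S $$ (i, j) * (if v j \<in> U then 1 else -1)"
      using ij unfolding D_def
      by (subst mat_diag_mult_left[of _ n n], simp, subst mat_diag_mult_right[of _ n n])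
        (auto simp: mat_diag_def)
    also have "\<dots> = - ?S $$ (i, j)"
      using UV ij by auto
    finally show "((-1) \<cdot>\<^sub>m ?S) $$ (i, j) = (D * ?S * D) $$ (i, j)"
      using ij carrier_matD[OF sombor_matrix_carrier[of G v n]] by simp
  qed (use D carrier_matD[OF sombor_matrix_carrier[of G v n]] in auto)
  then show ?thesis
    using D DD by (intro similar_matI[of _ _ D D n]) auto
qed

section \<open>The bound for a spectrum symmetric about 0\<close>

lemma symmetric_uminus_eigenvalues:
  fixes A :: "'a :: conjugatable_ordered_field mat"
  assumes A: "A \<in> carrier_mat n n" and es: "char_poly A = (\<Prod>e\<leftarrow>es. [:- e, 1:])"
    and sim: "similar_mat ((-1) \<cdot>\<^sub>m A) A"
  shows "mset (map uminus es) = mset es"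
  using char_poly_similar[OF sim] proots_prod_linear[of es] proots_prod_linear[of "map uminus es"]
  by (simp only: es char_poly_uminus_eigenvalues[OF A es])

lemma sum_cosh_bound:
  fixes F :: real
  assumes F: "0 < F" and sym: "mset (map uminus es) = mset es" and sq: "(\<Sum>e\<leftarrow>es. e\<^sup>2) = 2 * F"
  shows "(\<Sum>e\<leftarrow>es. exp e) \<le> real (length es) - 2 + 2 * cosh (sqrt F)"
    and "(\<Sum>e\<leftarrow>es. exp e) = real (length es) - 2 + 2 * cosh (sqrt F) \<longleftrightarrow> (\<forall>e\<in>set es. e ^ 3 = F * e)"
proof -
  have le: "e\<^sup>2 \<le> F" if e: "e \<in> set es" for e
  proof (cases "e = 0")
    case False
    have "- e \<in> set es"
      using e arg_cong[OF sym, of set_mset] by (metis image_eqI list.set_map set_mset_mset)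
    \<comment> \<open>As \<open>e\<close> is nonzero, \<open>e\<close> and \<open>- e\<close> are
      distinct, so membership of each suffices for the pair to be a submultiset. Its squares
      contribute \<open>2 * e^2\<close> to a total of \<open>2 * F\<close>.\<close>
    with e False have "{#e, - e#} \<subseteq># mset es"
      by (auto simp: insert_subset_eq_iff in_diff_count)
    then obtain M where M: "mset es = {#e, - e#} + M"
      by (auto simp: subset_mset.le_iff_add)
    have "(\<Sum>e\<leftarrow>es. e\<^sup>2) = (\<Sum>x\<in>#mset es. x\<^sup>2)"
      by (metis mset_map sum_mset_sum_list)
    also have "\<dots> = 2 * e\<^sup>2 + (\<Sum>x\<in>#M. x\<^sup>2)"
      by (simp add: M)
    finally show ?thesis
      using sq sum_mset_mono[of M "\<lambda>_. 0" "\<lambda>x. x\<^sup>2"] by auto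
  qed (use F in simp)
  \<comment> \<open>Negation permutes the spectrum, so the sums of \<open>exp (- e)\<close> and
    \<open>exp e\<close> agree, and both equal the sum of \<open>cosh e\<close>.\<close>
  have "(\<Sum>e\<leftarrow>es. exp (- e)) = (\<Sum>x\<in>#mset (map uminus es). exp x)"
    by (simp only: sum_mset_sum_list map_map o_def flip: mset_map)
  also have "\<dots> = (\<Sum>e\<leftarrow>es. exp e)"
    by (simp only: sym) (simp flip: sum_mset_sum_list)
  finally have exp_neg: "(\<Sum>e\<leftarrow>es. exp (- e)) = (\<Sum>e\<leftarrow>es. exp e)" .
  have "2 * (\<Sum>e\<leftarrow>es. cosh e) = (\<Sum>e\<leftarrow>es. exp e) + (\<Sum>e\<leftarrow>es. exp (- e))"
    by (induction es) (auto simp: cosh_field_def)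
  with exp_neg have cosh: "(\<Sum>e\<leftarrow>es. exp e) = (\<Sum>e\<leftarrow>es. cosh e)"
    by simp
  \<comment> \<open>The slack of the chord inequality at \<open>e\<close>. Since the squares sum to
    \<open>2 * F\<close>, the total slack is exactly \<open>F\<close> times the slack of the claimed
    bound, so equality holds iff every \<open>gap e\<close> vanishes.\<close>
  define gap where "gap e = e\<^sup>2 * (cosh (sqrt F) - 1) - F * (cosh e - 1)" for e
  have "sum_list (map gap es)
      = (\<Sum>e\<leftarrow>es. e\<^sup>2) * (cosh (sqrt F) - 1) - F * ((\<Sum>e\<leftarrow>es. cosh e) - length es)"
    unfolding gap_def by (induction es) (auto simp: algebra_simps)
  then have total: "sum_list (map gap es)
      = F * (real (length es) - 2 + 2 * cosh (sqrt F) - (\<Sum>e\<leftarrow>es. exp e))"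
    by (simp add: sq cosh algebra_simps)
  have gap: "0 \<le> gap e" "gap e = 0 \<longleftrightarrow> e ^ 3 = F * e" if "e \<in> set es" for e
  proof -
    show "0 \<le> gap e"
      using cosh_minus_one_chord(1)[OF F le[OF that]] by (simp add: gap_def)
    have "gap e = 0 \<longleftrightarrow> e = 0 \<or> e\<^sup>2 = F"
      using cosh_minus_one_chord(2)[OF F le[OF that]] by (auto simp: gap_def)
    also have "\<dots> \<longleftrightarrow> e * (e\<^sup>2 - F) = 0"
      by simp
    also have "e * (e\<^sup>2 - F) = e ^ 3 - F * e"
      by (simp add: algebra_simps power2_eq_square power3_eq_cube)
    finally show "gap e = 0 \<longleftrightarrow> e ^ 3 = F * e"
      by simp
  qed
  then have "0 \<le> sum_list (map gap es)"
    by (intro sum_list_nonneg) auto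
  then show "(\<Sum>e\<leftarrow>es. exp e) \<le> real (length es) - 2 + 2 * cosh (sqrt F)"
    using F by (simp add: total zero_le_mult_iff)
  have "(\<Sum>e\<leftarrow>es. exp e) = real (length es) - 2 + 2 * cosh (sqrt F) \<longleftrightarrow> sum_list (map gap es) = 0"
    using F by (auto simp: total)
  also have "\<dots> \<longleftrightarrow> (\<forall>e\<in>set es. e ^ 3 = F * e)"
    using gap by (subst sum_list_nonneg_eq_0_iff) auto
  finally show "(\<Sum>e\<leftarrow>es. exp e) = real (length es) - 2 + 2 * cosh (sqrt F)
      \<longleftrightarrow> (\<forall>e\<in>set es. e ^ 3 = F * e)" .
qed

section \<open>The cube equation and complete bipartite graphs\<close>

text \<open>With \<open>a\<close> and \<open>b\<close> the indicator vectors of \<open>U\<close> and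
  \<open>V\<close>, the matrix is \<open>c (a b^T + b a^T)\<close>. These vectors are orthogonal
  with squared norms \<open>s\<close> and \<open>t\<close>, so the square is
  \<open>c^2 (t a a^T + s b b^T)\<close> and the cube is \<open>s t c^2\<close> times the matrix.
  The factor is the sum of cubed degrees: \<open>s\<close> vertices have degree \<open>t\<close> and
  \<open>t\<close> have degree \<open>s\<close>.\<close>

lemma sombor_cube_complete_bipartite:
  fixes n :: nat
  assumes G: "pair_graph G" and v: "bij_betw v {..<n} (pverts G)"
    and UV: "pverts G = U \<union> V" "U \<inter> V = {}" "parcs G = U \<times> V \<union> V \<times> U"
  shows "sombor_matrix G v n ^\<^sub>m 3 = (\<Sum>i<n. real (vdegree G (v i)) ^ 3) \<cdot>\<^sub>m sombor_matrix G v n"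
proof -
  let ?S = "sombor_matrix G v n"
  define a b :: "nat \<Rightarrow> real" where "a i = of_bool (v i \<in> U)" and "b i = of_bool (v i \<in> V)" for i
  define s t where "s = (\<Sum>i<n. a i)" and "t = (\<Sum>i<n. b i)"
  define c where "c = sqrt (s\<^sup>2 + t\<^sup>2)"
  have ab: "a i * a i = a i" "b i * b i = b i" "a i * b i = 0" "b i * a i = 0" for i
    using UV(2) by (auto simp: a_def b_def)
  have deg: "real (vdegree G (v i)) = t * a i + s * b i" if "i < n" for i
  proof -
    have "real (vdegree G (v i)) = (\<Sum>j<n. a i * b j + b i * a j)"
      unfolding vdegree_eq_sum[OF G v that]
      using UV by (intro sum.cong refl) (auto simp: a_def b_def)
    also have "\<dots> = a i * t + b i * s"
      by (simp add: sum.distrib s_def t_def flip: sum_distrib_left)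
    finally show ?thesis
      by (simp add: mult.commute)
  qed
  have "real (vdegree G (v i)) ^ 3 = t ^ 3 * a i + s ^ 3 * b i" if "i < n" for i
    using UV(2) by (auto simp: deg[OF that] a_def b_def)
  then have F: "(\<Sum>i<n. real (vdegree G (v i)) ^ 3) = s * t * c\<^sup>2"
    by (simp add: sum.distrib c_def s_def[symmetric] t_def[symmetric] eval_nat_numeral algebra_simps
        flip: sum_distrib_left)
  have S: "?S $$ (i, j) = c * (a i * b j + b i * a j)" if "i < n" "j < n" for i j
    using that UV(2,3) by (auto simp: deg a_def b_def c_def add.commute)
  have S2: "(?S * ?S) $$ (i, j) = c\<^sup>2 * (t * (a i * a j) + s * (b i * b j))" if "i < n" "j < n" for i j
  proof -
    have "(?S * ?S) $$ (i, j) = (\<Sum>k<n. ?S $$ (i, k) * ?S $$ (k, j))"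
      using that by (intro index_mult_mat_sum) auto
    also have "\<dots> = (\<Sum>k<n. c\<^sup>2 * ((a i * a j) * b k + (b i * b j) * a k))"
    proof (intro sum.cong refl)
      fix k assume "k \<in> {..<n}"
      then have "?S $$ (i, k) * ?S $$ (k, j)
          = c\<^sup>2 * ((a i * a j) * (b k * b k) + (b i * b j) * (a k * a k)
              + (a i * b j) * (b k * a k) + (b i * a j) * (a k * b k))"
        using that by (simp add: S algebra_simps power2_eq_square del: index_sombor_matrix)
      then show "?S $$ (i, k) * ?S $$ (k, j) = c\<^sup>2 * ((a i * a j) * b k + (b i * b j) * a k)"
        by (simp add: ab)
    qed
    also have "\<dots> = c\<^sup>2 * ((a i * a j) * t + (b i * b j) * s)"
      by (simp add: sum.distrib s_def t_def flip: sum_distrib_left)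
    finally show ?thesis
      by (simp add: mult.commute)
  qed
  have "(?S * ?S * ?S) $$ (i, j) = s * t * c\<^sup>2 * ?S $$ (i, j)" if "i < n" "j < n" for i j
  proof -
    have "(?S * ?S * ?S) $$ (i, j) = (\<Sum>k<n. (?S * ?S) $$ (i, k) * ?S $$ (k, j))"
      using that by (intro index_mult_mat_sum[of _ n n]) (auto intro: mult_carrier_mat[of _ n n])
    also have "\<dots> = (\<Sum>k<n. c ^ 3 * (t * (a i * b j) * a k + s * (b i * a j) * b k))"
    proof (intro sum.cong refl)
      fix k assume "k \<in> {..<n}"
      then have "(?S * ?S) $$ (i, k) * ?S $$ (k, j)
          = c ^ 3 * (t * (a i * b j) * (a k * a k) + s * (b i * a j) * (b k * b k)
              + t * (a i * a j) * (a k * b k) + s * (b i * b j) * (b k * a k))"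
        using that
        by (simp add: S S2 algebra_simps eval_nat_numeral del: index_sombor_matrix index_mult_mat)
      then show "(?S * ?S) $$ (i, k) * ?S $$ (k, j)
          = c ^ 3 * (t * (a i * b j) * a k + s * (b i * a j) * b k)"
        by (simp add: ab)
    qed
    also have "\<dots> = c ^ 3 * (t * (a i * b j) * s + s * (b i * a j) * t)"
      by (simp add: sum.distrib s_def[symmetric] t_def[symmetric] flip: sum_distrib_left)
    finally show ?thesis
      using that by (simp add: S algebra_simps eval_nat_numeral del: index_sombor_matrix)
  qed
  then show ?thesis
    unfolding F by (intro eq_matI) (auto simp: numeral_3_eq_3 carrier_matD[OF sombor_matrix_carrier]
        simp del: index_mult_mat(1) index_sombor_matrix)
qed

text \<open>All entries are nonnegative and those at arcs are positive, so the walk yields a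
  positive summand, with nothing to cancel it, in the \<open>(x, w)\<close> entry of the cube. Hence
  the corresponding entry of the matrix itself is nonzero.\<close>

lemma sombor_cube_three_walk:
  fixes n :: nat
  assumes G: "pair_graph G" and v: "bij_betw v {..<n} (pverts G)"
    and cube: "sombor_matrix G v n ^\<^sub>m 3 = c \<cdot>\<^sub>m sombor_matrix G v n"
    and walk: "(x, y) \<in> parcs G" "(y, z) \<in> parcs G" "(z, w) \<in> parcs G"
  shows "(x, w) \<in> parcs G"
proof -
  interpret pair_graph G by fact
  let ?S = "sombor_matrix G v n"
  have obt: "\<exists>i<n. u = v i" if "u \<in> pverts G" for u
    using v that by (auto simp: bij_betw_def)
  obtain i j k l where idx: "i < n" "j < n" "k < n" "l < n" "x = v i" "y = v j" "z = v k" "w = v l"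
    using obt walk wellformed' by metis
  have pos: "0 < ?S $$ (p, q)" if "p < n" "q < n" "(v p, v q) \<in> parcs G" for p q
  proof -
    have "0 < real (vdegree G (v p))"
      unfolding vdegree_eq_sum[OF G v that(1)] using that by (intro sum_pos2[of _ q]) auto
    then show ?thesis using that by (simp add: add_pos_nonneg)
  qed
  have nonneg: "0 \<le> ?S $$ (p, q)" if "p < n" "q < n" for p q
    using that by simp
  have nonneg2: "0 \<le> (?S * ?S) $$ (p, q)" if "p < n" "q < n" for p q
    using that nonneg
    by (subst index_mult_mat_sum[of _ n n _ n])
      (auto intro!: sum_nonneg mult_nonneg_nonneg simp del: index_sombor_matrix)
  have "0 < (\<Sum>r<n. ?S $$ (i, r) * ?S $$ (r, k))"
    using idx walk pos nonneg
    by (intro sum_pos2[of _ j]) (auto intro!: mult_nonneg_nonneg simp del: index_sombor_matrix)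
  then have pos2: "0 < (?S * ?S) $$ (i, k)"
    using idx by (subst index_mult_mat_sum[of _ n n _ n]) auto
  have "0 < (\<Sum>r<n. (?S * ?S) $$ (i, r) * ?S $$ (r, l))"
    using idx walk pos nonneg pos2 nonneg2
    by (intro sum_pos2[of _ k])
      (auto intro!: mult_nonneg_nonneg simp del: index_sombor_matrix index_mult_mat)
  then have "0 < (?S * ?S * ?S) $$ (i, l)"
    using idx by (subst index_mult_mat_sum[of _ n n _ n]) (auto intro: mult_carrier_mat[of _ n n])
  also have "?S * ?S * ?S = c \<cdot>\<^sub>m ?S"
    using cube by (simp add: numeral_3_eq_3)
  finally have "?S $$ (i, l) \<noteq> 0"
    using idx carrier_matD[OF sombor_matrix_carrier[of G v n]] by (auto simp del: index_sombor_matrix)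
  then show ?thesis
    using idx by (auto split: if_splits)
qed

text \<open>Three-step walks can be shortened to one arc, so any vertex reachable from
  \<open>u\<close> is at distance at most 2. Between opposite sides only distance 1 has the right
  parity.\<close>

lemma connected_three_walk_complete:
  assumes G: "pair_graph G" and con: "Digraph_Component.connected (with_proj G)"
    and UV: "pverts G = U \<union> V" "U \<inter> V = {}"
      "\<And>u w. (u, w) \<in> parcs G \<Longrightarrow> (u \<in> U \<and> w \<in> V) \<or> (u \<in> V \<and> w \<in> U)"
    and walk: "\<And>x y z w. (x, y) \<in> parcs G \<Longrightarrow> (y, z) \<in> parcs G \<Longrightarrow> (z, w) \<in> parcs G
      \<Longrightarrow> (x, w) \<in> parcs G"
  shows "parcs G = U \<times> V \<union> V \<times> U"
proof -
  interpret pair_graph G by fact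
  have adj: "(u, w) \<in> parcs G" if "u \<in> U" "w \<in> V" for u w
  proof -
    \<comment> \<open>Symmetry of the arcs turns connectedness into the existence of directed
      paths.\<close>
    have "strongly_connected (with_proj G)"
      using con pair_sym_arcs symmetric_connected_imp_strongly_connected by simp
    then have "u \<rightarrow>\<^sup>*\<^bsub>with_proj G\<^esub> w"
      using that UV(1) by (auto simp: strongly_connected_def)
    then have "(u, w) \<in> (parcs G)\<^sup>*"
      using reachable_rtranclI by fastforce
    then have "w = u \<or> (u, w) \<in> parcs G \<or> (\<exists>x. (u, x) \<in> parcs G \<and> (x, w) \<in> parcs G)"
      by (induction rule: rtrancl_induct) (use walk in blast)+
    then show ?thesis
      using that UV by blast
  qed
  then show ?thesis
    using UV(3) arcs_symmetric by fast
qed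

text \<open>Two distinct vertices joined by a path force an arc at \<open>v 0\<close>. Positivity
  lets the chord inequality be applied with this sum as \<open>F\<close>; the existence of an arc
  makes both sides of a bipartition nonempty.\<close>

lemma connected_sum_degree_cubes_pos:
  fixes n :: nat
  assumes G: "pair_graph G" and v: "bij_betw v {..<n} (pverts G)" and n: "2 \<le> n"
    and con: "Digraph_Component.connected (with_proj G)"
  shows "0 < (\<Sum>i<n. real (vdegree G (v i)) ^ 3)" and "parcs G \<noteq> {}"
proof -
  interpret pair_graph G by fact
  have in_verts: "v 0 \<in> pverts G" "v 1 \<in> pverts G"
    using v n by (auto simp: bij_betw_def)
  have "v 0 \<noteq> v 1"
    using bij_betw_imp_inj_on[OF v] n by (simp add: inj_on_eq_iff)
  have "strongly_connected (with_proj G)"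
    using con pair_sym_arcs symmetric_connected_imp_strongly_connected by simp
  then have "v 0 \<rightarrow>\<^sup>*\<^bsub>with_proj G\<^esub> v 1"
    using in_verts by (auto simp: strongly_connected_def)
  then have "(v 0, v 1) \<in> (parcs G)\<^sup>*"
    using reachable_rtranclI by fastforce
  then obtain y where y: "(v 0, y) \<in> parcs G"
    using \<open>v 0 \<noteq> v 1\<close> by (meson converse_rtranclE)
  then show "parcs G \<noteq> {}" by auto
  obtain j where j: "j < n" "y = v j"
    using wellformed'(2)[OF y] v by (auto simp: bij_betw_def)
  have "0 < real (vdegree G (v 0))"
    using n y j
    by (subst vdegree_eq_sum[OF G v]) (auto intro!: sum_pos2[of _ j] simp del: sum_of_bool_eq)
  then show "0 < (\<Sum>i<n. real (vdegree G (v i)) ^ 3)"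
    using n by (intro sum_pos2[of _ 0]) auto
qed

lemma sombor_cube_iff_complete_bipartite:
  fixes n :: nat
  assumes G: "pair_graph G" and v: "bij_betw v {..<n} (pverts G)" and n: "2 \<le> n"
    and con: "Digraph_Component.connected (with_proj G)" and bip: "bipartite_graph G"
  shows "sombor_matrix G v n ^\<^sub>m 3 = (\<Sum>i<n. real (vdegree G (v i)) ^ 3) \<cdot>\<^sub>m sombor_matrix G v n
    \<longleftrightarrow> (\<exists>s t. s \<ge> 1 \<and> t \<ge> 1 \<and> s + t = n \<and> complete_bipartite_digraph s t (with_proj G))"
    (is "?cube \<longleftrightarrow> ?K")
proof
  interpret pair_graph G by fact
  assume ?cube
  obtain U V where UV: "pverts G = U \<union> V" "U \<inter> V = {}"
      "\<forall>(u, w) \<in> parcs G. (u \<in> U \<and> w \<in> V) \<or> (u \<in> V \<and> w \<in> U)"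
    using bip unfolding bipartite_graph_def by blast
  have arcs: "parcs G = U \<times> V \<union> V \<times> U"
    using connected_three_walk_complete[OF G con UV(1,2)] UV(3)
      sombor_cube_three_walk[OF G v \<open>?cube\<close>] by blast
  have fin: "finite U" "finite V"
    using pair_finite_verts UV(1) by auto
  have "U \<noteq> {}" "V \<noteq> {}"
    using connected_sum_degree_cubes_pos(2)[OF G v n con] arcs by auto
  then have "card U \<ge> 1" "card V \<ge> 1"
    using fin by (auto simp: Suc_le_eq card_gt_0_iff)
  moreover have "card U + card V = n"
    using bij_betw_same_card[OF v] UV fin by (simp add: card_Un_disjoint)
  moreover have "complete_bipartite_digraph (card U) (card V) (with_proj G)"
    unfolding complete_bipartite_digraph_pair_def using UV(1,2) arcs pair_finite_verts by blast
  ultimately show ?K by blast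
next
  assume ?K
  then obtain U V where "pverts G = U \<union> V" "U \<inter> V = {}" "parcs G = U \<times> V \<union> V \<times> U"
    unfolding complete_bipartite_digraph_pair_def by blast
  then show ?cube
    by (rule sombor_cube_complete_bipartite[OF G v])
qed

theorem theorem5p4:
  fixes G :: "'a pair_pre_digraph" and v :: "nat \<Rightarrow> 'a" and n :: nat and F :: real
  assumes "pair_graph G"
    and "bij_betw v {..<n} (pverts G)"
    and "n \<ge> 4"
    and "Digraph_Component.connected (with_proj G)"
    and "bipartite_graph G"
    and "F = (\<Sum>i<n. real (vdegree G (v i)) ^ 3)"
  shows "sombor_estrada G v n \<le> real n - 2 + 2 * cosh (sqrt F) \<and>
         (sombor_estrada G v n = real n - 2 + 2 * cosh (sqrt F) \<longleftrightarrow>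
            (\<exists>s t. s \<ge> 1 \<and> t \<ge> 1 \<and> s + t = n \<and> complete_bipartite_digraph s t (with_proj G)))"
proof -
  let ?S = "sombor_matrix G v n"
  note G = assms(1) and v = assms(2)
  have n: "2 \<le> n" using assms(3) by simp
  have F: "0 < F"
    unfolding assms(6) using connected_sum_degree_cubes_pos(1)[OF G v n assms(4)] .
  have sym: "transpose_mat ?S = ?S"
    by (rule sombor_matrix_symmetric[OF G])
  have "?S $$ (i, j) = ?S $$ (j, i)" if "i < n" "j < n" for i j
    using arg_cong[OF sym, of "\<lambda>M. M $$ (j, i)"] that carrier_matD[OF sombor_matrix_carrier[of G v n]]
    by (simp del: index_sombor_matrix)
  then obtain es where es: "char_poly ?S = (\<Prod>e\<leftarrow>es. [:- e, 1:])" "length es = n"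
    using char_poly_symmetric_splits[OF sombor_matrix_carrier] by blast
  have EE: "sombor_estrada G v n = (\<Sum>e\<leftarrow>es. exp e)"
    unfolding sombor_estrada_def sombor_eigenvalues_def es proots_prod_linear
    by (simp only: sum_mset_sum_list flip: mset_map)
  have neg: "mset (map uminus es) = mset es"
    using symmetric_uminus_eigenvalues[OF sombor_matrix_carrier es(1)]
      similar_uminus_sombor_matrix[OF assms(5)] .
  have sq: "(\<Sum>e\<leftarrow>es. e\<^sup>2) = 2 * F"
    using sum_sombor_matrix_squares[OF G v] sum_diag_pow_eigenvalues[OF sombor_matrix_carrier es(1)]
    by (simp add: assms(6))
  \<comment> \<open>Links the spectral form of the equality case to the matrix equation that
    characterizes complete bipartite graphs. The implication from eigenvalues to matrices is the one
    that rests on symmetry.\<close>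
  have "(\<forall>e\<in>set es. e ^ 3 = F * e) \<longleftrightarrow> ?S ^\<^sub>m 3 = F \<cdot>\<^sub>m ?S"
  proof
    assume "?S ^\<^sub>m 3 = F \<cdot>\<^sub>m ?S"
    moreover have "eigenvalue ?S e" if "e \<in> set es" for e
      using that by (auto simp: eigenvalue_root_char_poly[OF sombor_matrix_carrier] es
          poly_prod_list prod_list_zero_iff)
    ultimately show "\<forall>e\<in>set es. e ^ 3 = F * e"
      using eigenvalue_cube[OF sombor_matrix_carrier] by blast
  qed (use symmetric_cube_eq_smult[OF sombor_matrix_carrier sym es(1)] in blast)
  then show ?thesis
    using sum_cosh_bound[OF F neg sq] sombor_cube_iff_complete_bipartite[OF G v n assms(4,5)]
    unfolding EE es(2) assms(6) by blast
qed

end
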